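(* Let $N$ be a positive integer and let $a,b$ be real parameters such that no denominator in the definition of the functions below vanishes. The rational functions of $q$-Hahn type $\mathcal V_m(n)=\mathcal V_m(n;a,b,N;q)$ obey the following difference equation for $m,n=0,1,\dots,N$: $$\tilde{\mathcal B}_{n,m}\big(\mathcal V_m(n+1)-\mathcal V_m(n)\big)+\tilde{\mathcal D}_n\big(\mathcal V_m(n-1)-\mathcal V_m(n)\big)=[-m]_q[m+b-N]_q[a-b-2]_q\,\mathcal V_m(n),$$ where $$\tilde{\mathcal B}_{n,m}=q^{n-N}[N-n]_q[N-n-m+a-b-2]_q[m-n+a-2]_q,$$ $$\tilde{\mathcal D}_n=-q^{b-N}[n]_q[N-n+a-b-1]_q[N-n+a-b-2]_q.$$
   Context: $q$ is real, $q>0$, $q\ne1$; $[x]_q=\frac{1-q^x}{1-q}$; $(a;q)_0=1$, $(a;q)_k=\prod_{i=0}^{k-1}(1-aq^i)$. For $m=0,\dots,N$, $$\mathcal U_m(x;a,b,N;q)=q^{m(N-m-b)}\frac{(q^{-N};q)_m}{(q^{-m-b};q)_m}\sum_{k=0}^m\frac{(q^{-m};q)_k(q^{-x};q)_k(q^{b+m-N};q)_k}{(q^{-N};q)_k(q^{a-x};q)_k}\frac{q^k}{(q;q)_k},$$ $$\mathcal V_m(x;a,b,N;q)=\mathcal U_m(N-x;b-a+2,b,N;q^{-1}),$$ where in the second line $q$ is replaced by $q^{-1}$ everywhere in the definition of $\mathcal U_m$. Note that $\tilde{\mathcal B}_{N,m}=0$ and $\tilde{\mathcal D}_0=0$, so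 the values $\mathcal V_m(N+1)$ and $\mathcal V_m(-1)$ do not contribute. The nonvanishing of denominators holds for instance if $a$, $b$ and $a-b$ are not integers. *)

theory Defs
  imports Complex_Main
begin

definition qnum :: "real \<Rightarrow> real \<Rightarrow> real" where
  "qnum q x = (1 - q powr x) / (1 - q)"

definition qpoch :: "real \<Rightarrow> real \<Rightarrow> nat \<Rightarrow> real" where
  "qpoch a q k = (\<Prod>i<k. 1 - a * q ^ i)"

definition U :: "nat \<Rightarrow> real \<Rightarrow> real \<Rightarrow> real \<Rightarrow> nat \<Rightarrow> real \<Rightarrow> real" where
  "U m x a b N q =
     q powr (real m * (real N - real m - b))
       * (qpoch (q powr (- real N)) q m / qpoch (q powr (- real m - b)) q m)
       * (\<Sum>k=0..m. (qpoch (q powr (- real m)) q k * qpoch (q powr (- x)) q k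
                        * qpoch (q powr (b + real m - real N)) q k)
                      / (qpoch (q powr (- real N)) q k * qpoch (q powr (a - x)) q k)
                      * (q ^ k / qpoch q q k))"

definition V :: "nat \<Rightarrow> real \<Rightarrow> real \<Rightarrow> real \<Rightarrow> nat \<Rightarrow> real \<Rightarrow> real" where
  "V m x a b N q = U m (real N - x) (b - a + 2) b N (inverse q)"

text \<open>No denominator occurring in the formula for \<open>U m x a b N q\<close> vanishes; the
  predicate for \<open>V\<close> is obtained by the same substitution that defines \<open>V\<close> from \<open>U\<close>.\<close>

definition U_defined :: "nat \<Rightarrow> real \<Rightarrow> real \<Rightarrow> real \<Rightarrow> nat \<Rightarrow> real \<Rightarrow> bool" where
  "U_defined m x a b N q \<longleftrightarrow>
     qpoch (q powr (- real m - b)) q m \<noteq> 0 \<and>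
     (\<forall>k\<le>m. qpoch (q powr (- real N)) q k \<noteq> 0 \<and> qpoch (q powr (a - x)) q k \<noteq> 0
             \<and> qpoch q q k \<noteq> 0)"

definition V_defined :: "nat \<Rightarrow> real \<Rightarrow> real \<Rightarrow> real \<Rightarrow> nat \<Rightarrow> real \<Rightarrow> bool" where
  "V_defined m x a b N q \<longleftrightarrow> U_defined m (real N - x) (b - a + 2) b N (inverse q)"

definition B_tilde :: "nat \<Rightarrow> nat \<Rightarrow> real \<Rightarrow> real \<Rightarrow> nat \<Rightarrow> real \<Rightarrow> real" where
  "B_tilde n m a b N q =
     q powr (real n - real N) * qnum q (real N - real n)
       * qnum q (real N - real n - real m + a - b - 2) * qnum q (real m - real n + a - 2)"

definition D_tilde :: "nat \<Rightarrow> real \<Rightarrow> real \<Rightarrow> nat \<Rightarrow> real \<Rightarrow> real" where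
  "D_tilde n a b N q =
     - (q powr (b - real N)) * qnum q (real n)
       * qnum q (real N - real n + a - b - 1) * qnum q (real N - real n + a - b - 2)"

end

theory Submission
  imports Defs
begin

text \<open>
  Put \<open>p = 1/q\<close>, \<open>y = N - n\<close>, \<open>Y = p\<^bsup>-y\<^esup>\<close>, \<open>C = p\<^bsup>b-a+2\<^esup>\<close>, \<open>M = p\<^bsup>-m\<^esup>\<close>, \<open>F = p\<^bsup>b+m-N\<^esup>\<close>, \<open>P = p\<^bsup>-N\<^esup>\<close>.
  Up to a factor independent of \<open>n\<close>, \<open>\<V>\<^sub>m(n)\<close> is \<open>\<Sum>\<^sub>k A\<^sub>k (Y;p)\<^sub>k / (CY;p)\<^sub>k\<close>
  with \<open>A\<^sub>k = (M;p)\<^sub>k (F;p)\<^sub>k p\<^sup>k / ((P;p)\<^sub>k (p;p)\<^sub>k)\<close>, and the shifts \<open>n \<plusminus> 1\<close> become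
  \<open>Y \<mapsto> p\<^bsup>\<plusminus>1\<^esup> Y\<close>. Applying the (rescaled) difference operator to the \<open>k\<close>-th summand gives
  \<open>G\<^sub>k\<^sub>+\<^sub>1 - G\<^sub>k\<close> with
  \<open>G\<^sub>k\<^sub>+\<^sub>1 = - (1-C)(1-CY) A\<^sub>k (1 - M p\<^sup>k) (1 - F p\<^sup>k) p\<^bsup>-k\<^esup> (Y;p)\<^sub>k / (CY;p)\<^sub>k\<^sub>+\<^sub>1\<close>.
  The sum telescopes to \<open>G\<^sub>m\<^sub>+\<^sub>1 - G\<^sub>0\<close>, where \<open>G\<^sub>0 = 0\<close> and \<open>G\<^sub>m\<^sub>+\<^sub>1 = 0\<close> because \<open>M p\<^sup>m = 1\<close>.
\<close>

section \<open>Recurrences for q-Pochhammer symbols\<close>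

lemma qpoch_0 [simp]: "qpoch a q 0 = 1"
  by (simp add: qpoch_def)

lemma qpoch_Suc: "qpoch a q (Suc k) = qpoch a q k * (1 - a * q ^ k)"
  by (simp add: qpoch_def)

lemma qpoch_Suc_shift: "qpoch a q (Suc k) = (1 - a) * qpoch (a * q) q k"
  by (simp add: qpoch_def prod.lessThan_Suc_shift mult.assoc del: prod.lessThan_Suc)

lemma qpoch_shift: "(1 - a) * qpoch (a * q) q k = qpoch a q k * (1 - a * q ^ k)"
  using qpoch_Suc qpoch_Suc_shift by metis

lemma qpoch_nonzero_mono:
  assumes "qpoch a q k \<noteq> 0" "j \<le> k"
  shows "qpoch a q j \<noteq> 0"
  using assms by (auto simp: qpoch_def)

section \<open>The summands and their behaviour under Y -> p Y and Y -> Y / p\<close>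

definition hahn_coeff :: "real \<Rightarrow> real \<Rightarrow> real \<Rightarrow> real \<Rightarrow> nat \<Rightarrow> real" where
  "hahn_coeff p M F P k = qpoch M p k * qpoch F p k * p ^ k / (qpoch P p k * qpoch p p k)"

definition qratio :: "real \<Rightarrow> real \<Rightarrow> real \<Rightarrow> nat \<Rightarrow> real" where
  "qratio p C Y k = qpoch Y p k / qpoch (C * Y) p k"

lemma hahn_coeff_Suc:
  assumes "qpoch P p (Suc k) \<noteq> 0" "qpoch p p (Suc k) \<noteq> 0"
  shows "hahn_coeff p M F P (Suc k) * (1 - P * p ^ k) * (1 - p * p ^ k)
       = hahn_coeff p M F P k * (1 - M * p ^ k) * (1 - F * p ^ k) * p"
proof -
  have "1 - P * p ^ k \<noteq> 0" "1 - p * p ^ k \<noteq> 0" "qpoch P p k \<noteq> 0" "qpoch p p k \<noteq> 0"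
    using assms by (auto simp: qpoch_Suc)
  then show ?thesis
    by (simp add: hahn_coeff_def qpoch_Suc)
qed

text \<open>If \<open>Y = 1\<close> the value at \<open>p * Y\<close> and the denominator on the right may be junk, but both sides vanish.\<close>

lemma qratio_up:
  assumes "Y = 1 \<or> qpoch (C * (p * Y)) p k \<noteq> 0"
    and "C * Y \<noteq> 1" "qpoch (C * Y) p k \<noteq> 0"
  shows "(1 - Y) * (qratio p C (p * Y) k - qratio p C Y k)
       = Y * (1 - C) * (1 - p ^ k) * (qpoch Y p k / qpoch (C * Y) p (Suc k))"
proof (cases "Y = 1")
  case True
  then show ?thesis by (cases k) (auto simp: qpoch_Suc_shift)
next
  case False
  have nz: "qpoch (C * Y) p (Suc k) \<noteq> 0"
    using assms False by (simp add: qpoch_Suc_shift mult_ac)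
  then have nz': "1 - C * Y * p ^ k \<noteq> 0"
    by (simp add: qpoch_Suc)
  have num: "qpoch (p * Y) p k = qpoch Y p k * (1 - Y * p ^ k) / (1 - Y)"
    using qpoch_shift[of Y p k] False by (simp add: field_simps)
  have den: "qpoch (C * (p * Y)) p k = qpoch (C * Y) p k * (1 - C * Y * p ^ k) / (1 - C * Y)"
    using qpoch_shift[of "C * Y" p k] assms by (simp add: field_simps)
  have "(1 - Y) * (qratio p C (p * Y) k - qratio p C Y k)
      = qpoch Y p k / qpoch (C * Y) p k
        * (((1 - Y * p ^ k) * (1 - C * Y) - (1 - Y) * (1 - C * Y * p ^ k)) / (1 - C * Y * p ^ k))"
    unfolding qratio_def num den using assms nz' False by (simp add: divide_simps) algebra
  also have "(1 - Y * p ^ k) * (1 - C * Y) - (1 - Y) * (1 - C * Y * p ^ k) = Y * (1 - C) * (1 - p ^ k)"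
    by algebra
  finally show ?thesis
    by (simp add: qpoch_Suc mult_ac)
qed

text \<open>From index 1 on, both ratios share \<open>qpoch Y p k / qpoch (C * Y) p k\<close>, so
  only \<open>(1 - Y / p) / (1 - C * Y / p)\<close> and
  \<open>(1 - Y * p ^ k) / (1 - C * Y * p ^ k)\<close> have to be compared. At index 0 both ratios
  are 1.\<close>

lemma qratio_down:
  assumes "p \<noteq> 0" "qpoch (C * (Y / p)) p (Suc k) \<noteq> 0" "qpoch (C * Y) p (Suc k) \<noteq> 0"
  shows "(1 - C * Y / p) * (qratio p C (Y / p) (Suc k) - qratio p C Y (Suc k))
       = - (Y / p) * (1 - C) * (1 - p ^ Suc k) * (qpoch Y p k / qpoch (C * Y) p (Suc k))"
proof -
  have num: "qpoch (Y / p) p (Suc k) = (1 - Y / p) * qpoch Y p k"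
    using assms by (simp add: qpoch_Suc_shift)
  have den: "qpoch (C * (Y / p)) p (Suc k) = (1 - C * Y / p) * qpoch (C * Y) p k"
    using assms by (simp add: qpoch_Suc_shift)
  have nz: "1 - C * Y / p \<noteq> 0" "qpoch (C * Y) p k \<noteq> 0" "1 - C * Y * p ^ k \<noteq> 0"
    using assms(2,3) unfolding den by (auto simp: qpoch_Suc)
  have frac: "d * (x * u / (d * w) - u * y / (w * e)) = u / (w * e) * (x * e - y * d)"
    if "d \<noteq> 0" "w \<noteq> 0" "e \<noteq> 0" for d e u w x y :: real
    using that by (simp add: field_simps)
  have "(1 - C * Y / p) * (qratio p C (Y / p) (Suc k) - qratio p C Y (Suc k))
      = qpoch Y p k / qpoch (C * Y) p (Suc k)
        * ((1 - Y / p) * (1 - C * Y * p ^ k) - (1 - Y * p ^ k) * (1 - C * Y / p))"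
    unfolding qratio_def num den unfolding qpoch_Suc using nz by (rule frac)
  also have "(1 - Y / p) * (1 - C * Y * p ^ k) - (1 - Y * p ^ k) * (1 - C * Y / p)
      = - (Y / p) * (1 - C) * (1 - p ^ Suc k)"
    using assms(1) by (simp add: field_simps)
  finally show ?thesis by (simp add: mult_ac)
qed

section \<open>The telescoping certificate\<close>

text \<open>\<open>hahn_cert p M F P C Y k\<close> is \<open>G\<^sub>k\<^sub>+\<^sub>1\<close>.\<close>

definition hahn_cert :: "real \<Rightarrow> real \<Rightarrow> real \<Rightarrow> real \<Rightarrow> real \<Rightarrow> real \<Rightarrow> nat \<Rightarrow> real" where
  "hahn_cert p M F P C Y k =
     - (1 - C) * (1 - C * Y) * hahn_coeff p M F P k * (1 - M * p ^ k) * (1 - F * p ^ k) / p ^ k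
       * (qpoch Y p k / qpoch (C * Y) p (Suc k))"

text \<open>The difference equation in the variable Y, multiplied by M F (1 - q)^3, with the
  eigenvalue term moved to the left. The weights contain \<open>1 - Y\<close>, which vanishes at n =
  N, and \<open>1 - P / Y\<close>, which vanishes at n = 0.\<close>

definition hahn_op :: "real \<Rightarrow> real \<Rightarrow> real \<Rightarrow> real \<Rightarrow> real \<Rightarrow> real \<Rightarrow> (real \<Rightarrow> real) \<Rightarrow> real" where
  "hahn_op p M F P C Y f =
     (1 - Y) * (M - C * Y) * (F - C * Y) / Y * (f (p * Y) - f Y)
     - (1 - P / Y) * (1 - C * Y) * (1 - C * Y / p) * (f (Y / p) - f Y)
     - (1 - M) * (1 - F) * (1 - C) * f Y"

text \<open>First telescoping step: G_0 = 0 has no index in \<open>hahn_cert\<close>. The difference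
  terms drop out because the ratio is constantly 1.\<close>

lemma hahn_op_qratio_0:
  assumes "C * Y \<noteq> 1"
  shows "hahn_coeff p M F P 0 * hahn_op p M F P C Y (\<lambda>Z. qratio p C Z 0) = hahn_cert p M F P C Y 0"
  using assms by (simp add: hahn_op_def hahn_cert_def qratio_def hahn_coeff_def qpoch_Suc) algebra

text \<open>The disjunctions cover the endpoints n = N and n = 0, where a shifted ratio may have a
  zero denominator but is multiplied by a vanishing weight.\<close>

lemma hahn_op_qratio_Suc:
  assumes p: "p \<noteq> 0" and Y: "Y \<noteq> 0"
    and up: "Y = 1 \<or> qpoch (C * (p * Y)) p (Suc k) \<noteq> 0"
    and down: "Y = P \<or> qpoch (C * (Y / p)) p (Suc k) \<noteq> 0"
    and CY: "qpoch (C * Y) p (Suc k) \<noteq> 0"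
    and P: "qpoch P p (Suc k) \<noteq> 0" "qpoch p p (Suc k) \<noteq> 0"
  shows "hahn_coeff p M F P (Suc k) * hahn_op p M F P C Y (\<lambda>Z. qratio p C Z (Suc k))
       = hahn_cert p M F P C Y (Suc k) - hahn_cert p M F P C Y k"
proof -
  define K where "K = p ^ k"
  define A where "A = hahn_coeff p M F P (Suc k)"
  define W where "W = qpoch Y p k"
  define s where "s = 1 / qpoch (C * Y) p (Suc k)"
  define r where "r = 1 / qpoch (C * Y) p (Suc (Suc k))"
  have K: "K \<noteq> 0" using p by (simp add: K_def)
  have CY1: "C * Y \<noteq> 1" using CY by (simp add: qpoch_Suc_shift)
  have Y1: "qpoch Y p (Suc k) = W * (1 - Y * K)" by (simp add: W_def K_def qpoch_Suc)
  \<comment> \<open>The factor \<open>W * (1 - Y * K)\<close> stays on both sides because for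
    \<open>Y = 1\<close> the denominator in \<open>r\<close> may be 0, which makes \<open>r\<close>
    the default value 0; the factor is then 0 as well.\<close>
  have rs: "W * (1 - Y * K) * s = W * (1 - Y * K) * r * (1 - C * Y * (p * K))"
  proof (cases "Y = 1")
    case True
    then have "qpoch Y p (Suc k) = 0" by (simp add: qpoch_Suc_shift)
    then show ?thesis unfolding Y1 by (simp only: mult_zero_left)
  next
    case False
    have "qpoch (C * Y) p (Suc (Suc k)) = (1 - C * Y) * qpoch (C * (p * Y)) p (Suc k)"
      by (subst qpoch_Suc_shift) (simp add: mult_ac)
    then have "qpoch (C * Y) p (Suc (Suc k)) \<noteq> 0" using up False CY1 by simp
    moreover have "qpoch (C * Y) p (Suc (Suc k)) = qpoch (C * Y) p (Suc k) * (1 - C * Y * (p * K))"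
      by (subst qpoch_Suc) (simp add: K_def)
    ultimately have "s = r * (1 - C * Y * (p * K))" by (auto simp: s_def r_def)
    then show ?thesis by simp
  qed
  have U: "(1 - Y) * (qratio p C (p * Y) (Suc k) - qratio p C Y (Suc k))
         = Y * (1 - C) * (1 - p * K) * (W * (1 - Y * K) * r)"
    using qratio_up[OF up CY1 CY] unfolding Y1 by (simp add: r_def K_def)
  have D: "(1 - P / Y) * ((1 - C * Y / p) * (qratio p C (Y / p) (Suc k) - qratio p C Y (Suc k)))
         = (1 - P / Y) * (- (Y / p) * (1 - C) * (1 - p * K) * (W * s))"
  proof (cases "Y = P")
    case True
    then show ?thesis using Y by simp
  next
    case False
    then show ?thesis using qratio_down[OF p _ CY] down by (simp add: W_def s_def K_def)
  qed
  have L: "qratio p C Y (Suc k) = W * (1 - Y * K) * s"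
    by (simp only: qratio_def Y1 s_def) simp
  have "hahn_op p M F P C Y (\<lambda>Z. qratio p C Z (Suc k))
     = (M - C * Y) * (F - C * Y) / Y
         * ((1 - Y) * (qratio p C (p * Y) (Suc k) - qratio p C Y (Suc k)))
       - (1 - C * Y)
         * ((1 - P / Y) * ((1 - C * Y / p) * (qratio p C (Y / p) (Suc k) - qratio p C Y (Suc k))))
       - (1 - M) * (1 - F) * (1 - C) * qratio p C Y (Suc k)"
    by (simp add: hahn_op_def mult_ac)
  also have "\<dots> = (M - C * Y) * (F - C * Y) * (1 - C) * (1 - p * K) * (W * (1 - Y * K) * r)
       + (1 - C * Y) * (Y - P) / p * (1 - C) * (1 - p * K) * (W * s)
       - (1 - M) * (1 - F) * (1 - C) * (W * (1 - Y * K) * r * (1 - C * Y * (p * K)))"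
    unfolding U D unfolding L rs using Y p by (simp add: field_simps)
  finally have op: "hahn_op p M F P C Y (\<lambda>Z. qratio p C Z (Suc k)) = \<dots>" .
  have c1: "hahn_cert p M F P C Y (Suc k) =
     - (1 - C) * (1 - C * Y) * A * (1 - M * (p * K)) * (1 - F * (p * K)) / (p * K)
       * (W * (1 - Y * K) * r)"
    unfolding hahn_cert_def Y1 by (simp add: A_def r_def K_def)
  \<comment> \<open>The coefficient recurrence expresses this certificate value through the next
    coefficient \<open>A\<close>, so that \<open>A\<close> becomes a common factor of the whole
    identity.\<close>
  have "hahn_cert p M F P C Y k = - (1 - C) * (1 - C * Y) / (p * K) *
      (hahn_coeff p M F P k * (1 - M * p ^ k) * (1 - F * p ^ k) * p) * (W * s)"
    using p K by (simp add: hahn_cert_def W_def s_def K_def)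
  then have c0: "hahn_cert p M F P C Y k =
      - (1 - C) * (1 - C * Y) / (p * K) * (A * (1 - P * K) * (1 - p * K)) * (W * s)"
    using hahn_coeff_Suc[OF P] by (simp add: A_def K_def)
  define R where "R = W * (1 - Y * K) * r"
  have WsY: "W * s * (1 - Y * K) = R * (1 - C * Y * (p * K))"
    using rs by (simp add: R_def mult_ac)
  \<comment> \<open>Collecting the \<open>W * s\<close> terms cancels P and leaves a multiple of
    \<open>W * s * (1 - Y * K)\<close>. \<open>WsY\<close> turns it into a multiple of
    \<open>R\<close>, and a polynomial identity remains.\<close>
  have poly: "(M - C * Y) * (F - C * Y) * (1 - p * K) * R * (p * K)
       + (1 - C * Y) * (Y - P) * K * (1 - p * K) * (W * s)
       - (1 - M) * (1 - F) * (R * (1 - C * Y * (p * K))) * (p * K)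
     = - (1 - C * Y) * (1 - M * (p * K)) * (1 - F * (p * K)) * R
       + (1 - C * Y) * (1 - P * K) * (1 - p * K) * (W * s)"
    using WsY by algebra
  have op': "hahn_op p M F P C Y (\<lambda>Z. qratio p C Z (Suc k)) = (1 - C) / (p * K) *
      ((M - C * Y) * (F - C * Y) * (1 - p * K) * R * (p * K)
       + (1 - C * Y) * (Y - P) * K * (1 - p * K) * (W * s)
       - (1 - M) * (1 - F) * (R * (1 - C * Y * (p * K))) * (p * K))"
    unfolding op R_def[symmetric] using p K by (simp add: field_simps)
  show ?thesis
    unfolding op' poly A_def[symmetric] c1 c0 R_def[symmetric] using p K by (simp add: field_simps)
qed

lemma hahn_op_sum:
  "hahn_op p M F P C Y (\<lambda>Z. \<Sum>k\<in>I. c k * f Z k) = (\<Sum>k\<in>I. c k * hahn_op p M F P C Y (\<lambda>Z. f Z k))"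
proof -
  have "x * ((\<Sum>k\<in>I. c k * u k) - (\<Sum>k\<in>I. c k * v k))
        - y * ((\<Sum>k\<in>I. c k * w k) - (\<Sum>k\<in>I. c k * v k)) - z * (\<Sum>k\<in>I. c k * v k)
      = (\<Sum>k\<in>I. c k * (x * (u k - v k) - y * (w k - v k) - z * v k))" for x y z u v w
    by (simp add: sum_distrib_left sum_subtractf sum.distrib algebra_simps)
  then show ?thesis
    unfolding hahn_op_def .
qed

lemma hahn_op_eq_0:
  assumes p: "p \<noteq> 0" and Y: "Y \<noteq> 0" and M: "M * p ^ m = 1"
    and up: "Y = 1 \<or> qpoch (C * (p * Y)) p m \<noteq> 0"
    and down: "Y = P \<or> qpoch (C * (Y / p)) p m \<noteq> 0"
    and CY: "qpoch (C * Y) p m \<noteq> 0"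
    and P: "qpoch P p m \<noteq> 0" "qpoch p p m \<noteq> 0"
  shows "hahn_op p M F P C Y (\<lambda>Z. \<Sum>k=0..m. hahn_coeff p M F P k * qratio p C Z k) = 0"
\<comment> \<open>For \<open>m = 0\<close> the hypothesis \<open>CY\<close> is empty and does not
  yield \<open>C * Y \<noteq> 1\<close>; there \<open>M = 1\<close> and the sum is constant, so
  every term vanishes.\<close>
proof (cases "m = 0")
  case True
  then show ?thesis using M by (simp add: hahn_op_def qratio_def)
next
  case False
  then have CY1: "C * Y \<noteq> 1"
    using qpoch_nonzero_mono[OF CY, of 1] by (simp add: qpoch_def)
  have "(\<Sum>k=0..j. hahn_coeff p M F P k * hahn_op p M F P C Y (\<lambda>Z. qratio p C Z k))
      = hahn_cert p M F P C Y j" if "j \<le> m" for j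
    using that
  proof (induction j)
    case 0
    then show ?case using hahn_op_qratio_0[OF CY1] by simp
  next
    case (Suc j)
    have "hahn_coeff p M F P (Suc j) * hahn_op p M F P C Y (\<lambda>Z. qratio p C Z (Suc j))
        = hahn_cert p M F P C Y (Suc j) - hahn_cert p M F P C Y j"
      using up down qpoch_nonzero_mono[OF _ Suc.prems] CY P
      by (intro hahn_op_qratio_Suc p Y) blast+
    then show ?case using Suc by simp
  qed
  then show ?thesis
    using M by (simp add: hahn_op_sum hahn_cert_def)
qed

section \<open>Return to the functions V_m\<close>

lemma V_eq_hahn_sum:
  fixes q a b x :: real
  assumes "q > 0"
  defines "p \<equiv> inverse q"
  shows "V m x a b N q =
      p powr (real m * (real N - real m - b))
        * (qpoch (p powr (- real N)) p m / qpoch (p powr (- real m - b)) p m)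
        * (\<Sum>k=0..m. hahn_coeff p (p powr (- real m)) (p powr (b + real m - real N)) (p powr (- real N)) k
             * qratio p (p powr (b - a + 2)) (p powr (x - real N)) k)"
proof -
  have "p powr (b - a + 2 - (real N - x)) = p powr (b - a + 2) * p powr (x - real N)"
    by (simp add: powr_add[symmetric] algebra_simps)
  then show ?thesis
    unfolding V_def U_def p_def[symmetric]
    by (simp add: hahn_coeff_def qratio_def mult_ac)
qed

theorem proposition7p8:
  fixes q a b :: real and N m n :: nat
  assumes "q > 0" and "q \<noteq> 1" and "N > 0"
    and "\<And>j x. j \<le> N \<Longrightarrow> x \<le> N \<Longrightarrow> V_defined j (real x) a b N q"
    and "m \<le> N" and "n \<le> N"
  shows "B_tilde n m a b N q * (V m (real n + 1) a b N q - V m (real n) a b N q)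
           + D_tilde n a b N q * (V m (real n - 1) a b N q - V m (real n) a b N q)
         = qnum q (- real m) * qnum q (real m + b - real N) * qnum q (a - b - 2)
             * V m (real n) a b N q"
proof -
  define p where "p = inverse q"
  have p: "p > 0" using assms by (simp add: p_def)
  define C where "C = p powr (b - a + 2)"
  define Y where "Y = p powr (real n - real N)"
  define M where "M = p powr (- real m)"
  define F where "F = p powr (b + real m - real N)"
  define P where "P = p powr (- real N)"
  define S where "S Z = (\<Sum>k=0..m. hahn_coeff p M F P k * qratio p C Z k)" for Z
  define c where "c = p powr (real m * (real N - real m - b))
        * (qpoch (p powr (- real N)) p m / qpoch (p powr (- real m - b)) p m)"
  have pos: "C > 0" "Y > 0" "M > 0" "F > 0" "P > 0"
    using p by (auto simp: C_def Y_def M_def F_def P_def)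
  have V: "V m x a b N q = c * S (p powr (x - real N))" for x
    using V_eq_hahn_sum[OF assms(1), of m x a b N]
    by (simp add: c_def S_def p_def C_def M_def F_def P_def)
  have pY: "p powr (real n + 1 - real N) = p * Y" "p powr (real n - 1 - real N) = Y / p"
    using p by (simp_all add: Y_def powr_add powr_diff)
  have defined: "qpoch (C * p powr (real x - real N)) p m \<noteq> 0" "qpoch P p m \<noteq> 0" "qpoch p p m \<noteq> 0"
    if "x \<le> N" for x
    using assms(4)[OF assms(5) that]
    by (auto simp: V_defined_def U_defined_def p_def C_def P_def powr_add[symmetric] algebra_simps)
  \<comment> \<open>Definedness is assumed only at 0, ..., N. The shift to n + 1 leaves this range
    exactly when n = N, that is \<open>Y = 1\<close>; likewise n - 1 leaves it when n = 0, that is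
    \<open>Y = P\<close>.\<close>
  have up: "Y = 1 \<or> qpoch (C * (p * Y)) p m \<noteq> 0"
  proof (cases "n = N")
    case False
    then show ?thesis using defined(1)[of "Suc n"] assms(6) pY by (simp add: add.commute)
  qed (use p in \<open>simp add: Y_def\<close>)
  have down: "Y = P \<or> qpoch (C * (Y / p)) p m \<noteq> 0"
  proof (cases n)
    case (Suc k)
    then show ?thesis using defined(1)[of k] assms(6) pY by simp
  qed (simp add: Y_def P_def)
  have Mp: "M * p ^ m = 1"
    using p by (simp add: M_def powr_minus powr_realpow)
  have "hahn_op p M F P C Y S = 0"
    unfolding S_def
    using p pos Mp up down defined[OF assms(6)] by (intro hahn_op_eq_0) (auto simp: Y_def)
  then have main: "(1 - Y) * (M - C * Y) * (F - C * Y) / Y * (S (p * Y) - S Y)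
     - (1 - P / Y) * (1 - C * Y) * (1 - C * Y / p) * (S (Y / p) - S Y)
     = (1 - M) * (1 - F) * (1 - C) * S Y"
    by (simp add: hahn_op_def)
  have qp: "q powr x = p powr (- x)" for x
    by (simp add: p_def powr_minus inverse_powr powr_minus_divide)
  \<comment> \<open>Common normalisation: M F = p^(b - N), and each of the two weights and the
    eigenvalue is a product of three q-numbers, whence (1 - q)^3.\<close>
  define \<kappa> where "\<kappa> = 1 / (M * F * (1 - q) ^ 3)"
  have B: "B_tilde n m a b N q = \<kappa> * ((1 - Y) * (M - C * Y) * (F - C * Y) / Y)"
  proof -
    have e: "q powr (real n - real N) = 1 / Y" "q powr (real N - real n) = Y"
      "q powr (real N - real n - real m + a - b - 2) = C * Y / M"
      "q powr (real m - real n + a - 2) = C * Y / F"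
      using p by (simp_all add: qp C_def Y_def M_def F_def powr_add[symmetric] powr_diff[symmetric]
          powr_minus[symmetric] inverse_eq_divide[symmetric] algebra_simps)
    show ?thesis
      unfolding B_tilde_def qnum_def \<kappa>_def e using pos assms(2)
      by (simp add: divide_simps power3_eq_cube)
  qed
  have D: "D_tilde n a b N q = - \<kappa> * ((1 - P / Y) * (1 - C * Y) * (1 - C * Y / p))"
  proof -
    have "q powr (b - real N) = 1 / (M * F)" "q powr (real n) = P / Y"
      "q powr (real N - real n + a - b - 2) = C * Y"
      by (simp_all add: qp C_def Y_def M_def F_def P_def powr_add[symmetric]
          powr_diff[symmetric] powr_minus[symmetric] inverse_eq_divide[symmetric] algebra_simps)
    moreover have "q powr (real N - real n + a - b - 1) = C * Y / p"
    proof -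
      have "C * Y / p = p powr (b - a + 2 + (real n - real N) - 1)"
        using p by (simp add: C_def Y_def powr_add powr_diff power2_eq_square mult_ac)
      then show ?thesis by (simp add: qp algebra_simps)
    qed
    ultimately show ?thesis
      unfolding D_tilde_def qnum_def \<kappa>_def
      by (simp add: power3_eq_cube mult_ac)
  qed
  have L: "qnum q (- real m) * qnum q (real m + b - real N) * qnum q (a - b - 2)
      = \<kappa> * ((1 - M) * (1 - F) * (1 - C))"
  proof -
    have e: "q powr (- real m) = 1 / M" "q powr (real m + b - real N) = 1 / F"
      "q powr (a - b - 2) = C"
      using p by (simp_all add: qp C_def M_def F_def powr_minus[symmetric]
          inverse_eq_divide[symmetric] algebra_simps)
    show ?thesis
      unfolding qnum_def \<kappa>_def e using pos assms(2)
      by (simp add: divide_simps power3_eq_cube) algebra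
  qed
  have "B_tilde n m a b N q * (V m (real n + 1) a b N q - V m (real n) a b N q)
           + D_tilde n a b N q * (V m (real n - 1) a b N q - V m (real n) a b N q)
      = \<kappa> * c * ((1 - Y) * (M - C * Y) * (F - C * Y) / Y * (S (p * Y) - S Y)
     - (1 - P / Y) * (1 - C * Y) * (1 - C * Y / p) * (S (Y / p) - S Y))"
    unfolding B D V pY Y_def[symmetric] by algebra
  also have "\<dots> = \<kappa> * ((1 - M) * (1 - F) * (1 - C)) * (c * S Y)"
    unfolding main by simp
  finally show ?thesis
    unfolding L V Y_def[symmetric] .
qed

end
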